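(* Let $X$ be a regular topological space. For a cardinal $\kappa$ and a property $B$, write $(aSSL,(<\kappa,B))$ for "$X$ is absolutely strongly star-Lindelöf and $X$ is a union of fewer than $\kappa$ subspaces each of which has property $B$". Let $H$ and $M$ denote Hurewicz and Menger. Then all of the following implications hold for $X$: (1) $(aSSL,(<\mathfrak{d},H))$ implies that $X$ is selectively strongly star-Menger; (2) $(aSSL,(<\mathfrak{b},H))$ implies that $X$ is selectively strongly star-Hurewicz; (3) $(aSSL,(<\mathfrak{b},M))$ implies that $X$ is selectively strongly star-Menger; (4) $(aSSL,(<\mathfrak{b},H))$ implies $(aSSL,(<\mathfrak{d},H))$; (5) $(aSSL,(<\mathfrak{b},H))$ implies $(aSSL,(<\mathfrak{b},M))$; (6) if $X$ is selectively strongly star-Hurewicz then $X$ is selectively strongly star-Menger.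
   Context: Regular spaces are assumed to be $T_1$. For a family $\mathcal{U}$ of subsets of $X$ and $A\subseteq X$, $St(A,\mathcal{U})=\bigcup\{U\in\mathcal{U}: U\cap A\neq\emptyset\}$. A space $X$ is: - Menger ($M$) if for each sequence $\{\mathcal{U}_n:n\in\omega\}$ of open covers of $X$ there are finite $\mathcal{V}_n\subseteq\mathcal{U}_n$ such that $\{\bigcup\mathcal{V}_n:n\in\omega\}$ covers $X$; - Hurewicz ($H$) if for each such sequence there are finite $\mathcal{V}_n\subseteq\mathcal{U}_n$ such that each $x\in X$ belongs to $\bigcup\mathcal{V}_n$ for all but finitely many $n$; - absolutely strongly star-Lindelöf ($aSSL$) if for any open cover $\mathcal{U}$ of $X$ and any dense $D\subseteq X$ there is a countable $C\subseteq D$ with $St(C,\mathcal{U})=X$; - selectively strongly star-Menger if for each sequence $\{\mathcal{U}_n:n\in\omega\}$ of open covers of $X$ and each sequence $\{D_n:n\in\omega\}$ of dense subsets of $X$ there are finite $F_n\subseteq D_n$ such that $\{St(F_n,\mathcal{U}_n):n\in\omega\}$ covers $X$; - selectively strongly star-Hurewicz if for each sequence $\{\mathcal{U}_n:n\in\omega\}$ of open covers of $X$ and each sequence $\{D_n:n\in\omega\}$ of dense subsets of $X$ there are finite $F_n\subseteq D_n$ such that each $x\in X$ belongs to $St(F_n,\mathcal{U}_n)$ for all but finitely many $n$. For $f,g\in\omega^\omega$, $f\leq^* g$ means $f(n)\leq g(n)$ for all but finitely many $n$. $\mathfrak{b}$ is the least cardinality of a subset of $\omega^\omega$ that is unbounded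 with respect to $\leq^*$; $\mathfrak{d}$ is the least cardinality of a set $D\subseteq\omega^\omega$ that is dominating (every $g\in\omega^\omega$ satisfies $g\leq^* f$ for some $f\in D$). *)

theory Defs
  imports "HOL-Analysis.Analysis"
begin

definition star :: "'a set \<Rightarrow> 'a set set \<Rightarrow> 'a set" where
  "star A \<U> = \<Union>{U \<in> \<U>. U \<inter> A \<noteq> {}}"

definition open_cover :: "'a topology \<Rightarrow> 'a set set \<Rightarrow> bool" where
  "open_cover X \<U> \<longleftrightarrow> (\<forall>U\<in>\<U>. openin X U) \<and> \<Union>\<U> = topspace X"

definition dense_subset :: "'a topology \<Rightarrow> 'a set \<Rightarrow> bool" where
  "dense_subset X D \<longleftrightarrow> D \<subseteq> topspace X \<and> X closure_of D = topspace X"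

definition menger_space :: "'a topology \<Rightarrow> bool" where
  "menger_space X \<longleftrightarrow>
    (\<forall>\<U> :: nat \<Rightarrow> 'a set set. (\<forall>n. open_cover X (\<U> n)) \<longrightarrow>
      (\<exists>\<V>. (\<forall>n. finite (\<V> n) \<and> \<V> n \<subseteq> \<U> n) \<and>
        (\<forall>x\<in>topspace X. \<exists>n. x \<in> \<Union>(\<V> n))))"

definition hurewicz_space :: "'a topology \<Rightarrow> bool" where
  "hurewicz_space X \<longleftrightarrow>
    (\<forall>\<U> :: nat \<Rightarrow> 'a set set. (\<forall>n. open_cover X (\<U> n)) \<longrightarrow>
      (\<exists>\<V>. (\<forall>n. finite (\<V> n) \<and> \<V> n \<subseteq> \<U> n) \<and>
        (\<forall>x\<in>topspace X. \<forall>\<^sub>\<infinity>n. x \<in> \<Union>(\<V> n))))"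

definition abs_strongly_star_lindelof :: "'a topology \<Rightarrow> bool" where
  "abs_strongly_star_lindelof X \<longleftrightarrow>
    (\<forall>\<U> D. open_cover X \<U> \<and> dense_subset X D \<longrightarrow>
      (\<exists>C. countable C \<and> C \<subseteq> D \<and> star C \<U> = topspace X))"

definition sel_strongly_star_menger :: "'a topology \<Rightarrow> bool" where
  "sel_strongly_star_menger X \<longleftrightarrow>
    (\<forall>(\<U> :: nat \<Rightarrow> 'a set set) (D :: nat \<Rightarrow> 'a set).
      (\<forall>n. open_cover X (\<U> n)) \<and> (\<forall>n. dense_subset X (D n)) \<longrightarrow>
      (\<exists>F. (\<forall>n. finite (F n) \<and> F n \<subseteq> D n) \<and>
        (\<forall>x\<in>topspace X. \<exists>n. x \<in> star (F n) (\<U> n))))"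

definition sel_strongly_star_hurewicz :: "'a topology \<Rightarrow> bool" where
  "sel_strongly_star_hurewicz X \<longleftrightarrow>
    (\<forall>(\<U> :: nat \<Rightarrow> 'a set set) (D :: nat \<Rightarrow> 'a set).
      (\<forall>n. open_cover X (\<U> n)) \<and> (\<forall>n. dense_subset X (D n)) \<longrightarrow>
      (\<exists>F. (\<forall>n. finite (F n) \<and> F n \<subseteq> D n) \<and>
        (\<forall>x\<in>topspace X. \<forall>\<^sub>\<infinity>n. x \<in> star (F n) (\<U> n))))"

definition le_star :: "(nat \<Rightarrow> nat) \<Rightarrow> (nat \<Rightarrow> nat) \<Rightarrow> bool" where
  "le_star f g \<longleftrightarrow> (\<forall>\<^sub>\<infinity>n. f n \<le> g n)"

definition unbounded_family :: "(nat \<Rightarrow> nat) set \<Rightarrow> bool" where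
  "unbounded_family B \<longleftrightarrow> \<not> (\<exists>g. \<forall>f\<in>B. le_star f g)"

definition dominating_family :: "(nat \<Rightarrow> nat) set \<Rightarrow> bool" where
  "dominating_family D \<longleftrightarrow> (\<forall>g. \<exists>f\<in>D. le_star g f)"

text \<open>Cardinals are represented, as in the HOL theory of cardinals, by cardinal orders up to
  order isomorphism; the least cardinality of a set satisfying \<open>P\<close> is the cardinal of an
  arbitrarily chosen set of minimal cardinality. The choice is well defined as soon as some set
  satisfies \<open>P\<close>.\<close>

definition least_card :: "('a set \<Rightarrow> bool) \<Rightarrow> 'a rel" where
  "least_card P = card_of (SOME A. P A \<and> (\<forall>B. P B \<longrightarrow> (card_of A, card_of B) \<in> ordLeq))"

lemma least_card:
  assumes "P A0"
  shows "\<exists>A. P A \<and> least_card P = card_of A \<and> (\<forall>B. P B \<longrightarrow> (card_of A, card_of B) \<in> ordLeq)"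
proof -
  have "\<exists>r\<in>card_of ` Collect P. \<forall>r'\<in>card_of ` Collect P. (r, r') \<in> ordLeq"
    using assms by (intro exists_minim_Card_order) (auto simp: card_of_Card_order)
  then have "\<exists>A. P A \<and> (\<forall>B. P B \<longrightarrow> (card_of A, card_of B) \<in> ordLeq)"
    by auto
  from someI_ex[OF this] show ?thesis
    unfolding least_card_def by blast
qed

definition bounding_number :: "(nat \<Rightarrow> nat) rel" where
  "bounding_number = least_card unbounded_family"

definition dominating_number :: "(nat \<Rightarrow> nat) rel" where
  "dominating_number = least_card dominating_family"

lemma dominating_family_UNIV: "dominating_family UNIV"
proof -
  have "le_star g g" for g
    by (simp add: le_star_def)
  then show ?thesis
    unfolding dominating_family_def by blast
qed

lemma unbounded_family_UNIV: "unbounded_family UNIV"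
proof -
  have "\<not> le_star (\<lambda>n. Suc (g n)) g" for g
    by (simp add: le_star_def)
  then show ?thesis
    unfolding unbounded_family_def by blast
qed

definition union_of_fewer :: "'b rel \<Rightarrow> ('a topology \<Rightarrow> bool) \<Rightarrow> 'a topology \<Rightarrow> bool" where
  "union_of_fewer \<kappa> B X \<longleftrightarrow>
    (\<exists>\<S>. (card_of \<S>, \<kappa>) \<in> ordLess \<and> \<Union>\<S> = topspace X \<and>
      (\<forall>S\<in>\<S>. B (subtopology X S)))"

definition aSSL_fewer :: "'b rel \<Rightarrow> ('a topology \<Rightarrow> bool) \<Rightarrow> 'a topology \<Rightarrow> bool" where
  "aSSL_fewer \<kappa> B X \<longleftrightarrow> abs_strongly_star_lindelof X \<and> union_of_fewer \<kappa> B X"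

end

theory Submission
  imports Defs
begin

text \<open>
  Given open covers \<open>\<U>\<^sub>n\<close> and dense sets \<open>D\<^sub>n\<close>, the absolute strong star-Lindeloef property yields
  countable \<open>C\<^sub>n \<subseteq> D\<^sub>n\<close> whose stars are all of \<open>X\<close>. Exhausting each \<open>C\<^sub>n\<close> by an increasing
  sequence of finite sets \<open>E\<^sub>n\<^sub>,\<^sub>k\<close> turns the search for finite sets \<open>F\<^sub>n \<subseteq> D\<^sub>n\<close> into the search for
  one function \<open>g\<close>, with \<open>F\<^sub>n = E\<^sub>n\<^sub>,\<^sub>k\<close> for \<open>k = g(n)\<close>; larger values of \<open>g\<close> only enlarge the stars.

  Each piece \<open>S\<close> of \<open>X\<close> has its own function \<open>f\<^sub>S\<close>. If \<open>S\<close> is Hurewicz, \<open>f\<^sub>S\<close> can be chosen to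
  capture every \<open>x \<in> S\<close> (that is, \<open>x\<close> lies in the star of \<open>E\<^sub>n\<^sub>,\<^sub>k\<close> for \<open>k = f\<^sub>S(n)\<close>) at almost all \<open>n\<close>; if \<open>S\<close> is Menger, \<open>x\<close> is
  captured at infinitely many \<open>n\<close>, once the Menger property has been applied to every tail of the
  sequence of covers. The functions of fewer than \<open>\<bb>\<close> pieces have a common bound \<open>g\<close> modulo finite
  sets, and then \<open>g \<ge> f\<^sub>S\<close> almost everywhere preserves either kind of capture. The functions of fewer
  than \<open>\<dd>\<close> pieces do not dominate some \<open>g\<close>, so \<open>g > f\<^sub>S\<close> infinitely often; this meets ``almost all
  \<open>n\<close>'', which is why the Hurewicz property of the pieces is used with \<open>\<dd>\<close>. The remaining
  implications come from \<open>\<bb> \<le> \<dd>\<close> and from the fact that ``almost all \<open>n\<close>'' implies ``some \<open>n\<close>''.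
\<close>

section \<open>Bounding and dominating numbers\<close>

lemma least_card_le:
  assumes "P B"
  shows "(least_card P, card_of B) \<in> ordLeq"
  using least_card[of P B] assms by auto

lemma not_of_card_less_least_card:
  assumes "(card_of B, least_card P) \<in> ordLess"
  shows "\<not> P B"
  using least_card_le[of P B] assms not_ordLess_ordLeq by blast

lemma bounded_if_fewer_than_bounding_number:
  fixes f :: "'b \<Rightarrow> nat \<Rightarrow> nat"
  assumes "(card_of \<S>, bounding_number) \<in> ordLess"
  obtains g where "\<And>S. S \<in> \<S> \<Longrightarrow> le_star (f S) g"
proof -
  have "(card_of (f ` \<S>), bounding_number) \<in> ordLess"
    using card_of_image assms ordLeq_ordLess_trans by blast
  then have "\<not> unbounded_family (f ` \<S>)"
    unfolding bounding_number_def by (rule not_of_card_less_least_card)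
  then show ?thesis
    using that unfolding unbounded_family_def by auto
qed

lemma not_dominated_if_fewer_than_dominating_number:
  fixes f :: "'b \<Rightarrow> nat \<Rightarrow> nat"
  assumes "(card_of \<S>, dominating_number) \<in> ordLess"
  obtains g where "\<And>S. S \<in> \<S> \<Longrightarrow> \<exists>\<^sub>\<infinity>n. f S n < g n"
proof -
  have "(card_of (f ` \<S>), dominating_number) \<in> ordLess"
    using card_of_image assms ordLeq_ordLess_trans by blast
  then have "\<not> dominating_family (f ` \<S>)"
    unfolding dominating_number_def by (rule not_of_card_less_least_card)
  then obtain g where "\<And>S. S \<in> \<S> \<Longrightarrow> \<not> le_star g (f S)"
    unfolding dominating_family_def by auto
  then have "\<exists>\<^sub>\<infinity>n. f S n < g n" if "S \<in> \<S>" for S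
    using that by (fastforce simp: le_star_def not_MOST not_le)
  then show ?thesis
    using that by blast
qed

text \<open>A bound \<open>g\<close> of a dominating family would be a bound of all functions, including \<open>g + 1\<close>.\<close>

lemma unbounded_family_if_dominating_family:
  assumes "dominating_family D"
  shows "unbounded_family D"
  unfolding unbounded_family_def
proof
  assume "\<exists>g. \<forall>f\<in>D. le_star f g"
  then obtain g where g: "\<And>f. f \<in> D \<Longrightarrow> le_star f g"
    by blast
  obtain f where f: "f \<in> D" "le_star (\<lambda>n. Suc (g n)) f"
    using assms unfolding dominating_family_def by blast
  have "\<forall>\<^sub>\<infinity>n. Suc (g n) \<le> f n \<and> f n \<le> g n"
    using f(2) g[OF f(1)] by (auto simp: le_star_def MOST_conj_distrib)
  then have "\<forall>\<^sub>\<infinity>n::nat. False"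
    by (rule MOST_mono) auto
  then show False
    by simp
qed

lemma bounding_number_le_dominating_number:
  "(bounding_number, dominating_number) \<in> ordLeq"
proof -
  obtain D where "dominating_family D" "dominating_number = card_of D"
    unfolding dominating_number_def using least_card[of dominating_family, OF dominating_family_UNIV]
    by blast
  then show ?thesis
    unfolding bounding_number_def
    using least_card_le[of unbounded_family D] by (simp add: unbounded_family_if_dominating_family)
qed

section \<open>Implications between the properties\<close>

lemma union_of_fewer_mono:
  assumes "union_of_fewer \<kappa> B X" "(\<kappa>, \<mu>) \<in> ordLeq" "\<And>Y. B Y \<Longrightarrow> B' Y"
  shows "union_of_fewer \<mu> B' X"
  using assms ordLess_ordLeq_trans unfolding union_of_fewer_def by blast

lemma menger_space_if_hurewicz_space:
  assumes "hurewicz_space X"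
  shows "menger_space X"
  unfolding menger_space_def
proof (intro allI impI)
  fix \<U> :: "nat \<Rightarrow> 'a set set"
  assume "\<forall>n. open_cover X (\<U> n)"
  from assms[unfolded hurewicz_space_def, THEN spec, THEN mp, OF this]
  obtain \<V> where "\<forall>n. finite (\<V> n) \<and> \<V> n \<subseteq> \<U> n"
    and "\<forall>x\<in>topspace X. \<forall>\<^sub>\<infinity>n. x \<in> \<Union>(\<V> n)"
    by (elim exE conjE)
  then show "\<exists>\<V>. (\<forall>n. finite (\<V> n) \<and> \<V> n \<subseteq> \<U> n) \<and> (\<forall>x\<in>topspace X. \<exists>n. x \<in> \<Union>(\<V> n))"
    by (meson INFM_EX MOST_INFM infinite_UNIV_nat)
qed

lemma sel_strongly_star_menger_if_hurewicz:
  assumes "sel_strongly_star_hurewicz X"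
  shows "sel_strongly_star_menger X"
  unfolding sel_strongly_star_menger_def
proof (intro allI impI)
  fix \<U> :: "nat \<Rightarrow> 'a set set" and D :: "nat \<Rightarrow> 'a set"
  assume "(\<forall>n. open_cover X (\<U> n)) \<and> (\<forall>n. dense_subset X (D n))"
  from assms[unfolded sel_strongly_star_hurewicz_def, THEN spec, THEN spec, THEN mp, OF this]
  obtain F where "\<forall>n. finite (F n) \<and> F n \<subseteq> D n"
    and "\<forall>x\<in>topspace X. \<forall>\<^sub>\<infinity>n. x \<in> star (F n) (\<U> n)"
    by (elim exE conjE)
  then show "\<exists>F. (\<forall>n. finite (F n) \<and> F n \<subseteq> D n) \<and>
      (\<forall>x\<in>topspace X. \<exists>n. x \<in> star (F n) (\<U> n))"
    by (meson INFM_EX MOST_INFM infinite_UNIV_nat)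
qed

section \<open>Increasing covers\<close>

text \<open>A finite subfamily of an increasing cover is contained in a single one of its members, so
  for increasing covers the finite subfamilies in the Hurewicz and Menger properties reduce to
  indices.\<close>

lemma finite_subfamily_of_increasing:
  fixes W :: "nat \<Rightarrow> 'a set"
  assumes "mono W" "finite \<V>" "\<V> \<subseteq> range W"
  obtains k where "\<Union>\<V> \<subseteq> W k"
proof -
  obtain K where K: "finite K" "\<V> = W ` K"
    using finite_subset_image[OF assms(2,3)] by blast
  have "W i \<subseteq> W (Max K)" if "i \<in> K" for i
    using that K(1) \<open>mono W\<close> by (simp add: monoD)
  then have "\<Union>\<V> \<subseteq> W (Max K)"
    unfolding K(2) by blast
  then show ?thesis
    by (rule that)
qed

lemma open_cover_subtopology:
  assumes "\<And>k. openin X (W k)" "S \<subseteq> topspace X" "S \<subseteq> (\<Union>k::nat. W k)"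
  shows "open_cover (subtopology X S) (range (\<lambda>k. W k \<inter> S))"
  unfolding open_cover_def using assms by (auto simp: openin_subtopology)

lemma hurewicz_increasing_covers:
  fixes W :: "nat \<Rightarrow> nat \<Rightarrow> 'a set"
  assumes "hurewicz_space (subtopology X S)" "S \<subseteq> topspace X"
    and op: "\<And>n k. openin X (W n k)" and mono: "\<And>n. mono (W n)"
    and cov: "\<And>n. S \<subseteq> (\<Union>k. W n k)"
  shows "\<exists>f. \<forall>x\<in>S. \<forall>\<^sub>\<infinity>n. x \<in> W n (f n)"
proof -
  have "\<forall>n. open_cover (subtopology X S) (range (\<lambda>k. W n k \<inter> S))"
    using open_cover_subtopology[OF op \<open>S \<subseteq> topspace X\<close> cov] by blast
  from assms(1)[unfolded hurewicz_space_def, THEN spec, THEN mp, OF this]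
  obtain \<V> where "\<forall>n. finite (\<V> n) \<and> \<V> n \<subseteq> range (\<lambda>k. W n k \<inter> S)"
    and x: "\<forall>x\<in>topspace (subtopology X S). \<forall>\<^sub>\<infinity>n. x \<in> \<Union>(\<V> n)"
    by (elim exE conjE)
  then have \<V>: "\<And>n. finite (\<V> n)" "\<And>n. \<V> n \<subseteq> range (\<lambda>k. W n k \<inter> S)"
    by simp_all
  have "\<exists>k. \<Union>(\<V> n) \<subseteq> W n k \<inter> S" for n
  proof -
    have "mono (\<lambda>k. W n k \<inter> S)"
      using mono[of n] by (auto simp: mono_def)
    then show ?thesis
      by (rule finite_subfamily_of_increasing[OF _ \<V>(1)[of n] \<V>(2)[of n]]) (rule exI)
  qed
  then obtain f where f: "\<And>n. \<Union>(\<V> n) \<subseteq> W n (f n) \<inter> S"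
    by metis
  have "\<forall>\<^sub>\<infinity>n. x \<in> W n (f n)" if "x \<in> S" for x
  proof (rule MOST_mono)
    show "\<forall>\<^sub>\<infinity>n. x \<in> \<Union>(\<V> n)"
      using x that \<open>S \<subseteq> topspace X\<close> by auto
  qed (use f in blast)
  then show ?thesis
    by blast
qed

lemma menger_increasing_covers:
  fixes W :: "nat \<Rightarrow> nat \<Rightarrow> 'a set"
  assumes "menger_space (subtopology X S)" "S \<subseteq> topspace X"
    and op: "\<And>n k. openin X (W n k)" and mono: "\<And>n. mono (W n)"
    and cov: "\<And>n. S \<subseteq> (\<Union>k. W n k)"
  shows "\<exists>f. \<forall>x\<in>S. \<exists>n. x \<in> W n (f n)"
proof -
  have "\<forall>n. open_cover (subtopology X S) (range (\<lambda>k. W n k \<inter> S))"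
    using open_cover_subtopology[OF op \<open>S \<subseteq> topspace X\<close> cov] by blast
  from assms(1)[unfolded menger_space_def, THEN spec, THEN mp, OF this]
  obtain \<V> where "\<forall>n. finite (\<V> n) \<and> \<V> n \<subseteq> range (\<lambda>k. W n k \<inter> S)"
    and x: "\<forall>x\<in>topspace (subtopology X S). \<exists>n. x \<in> \<Union>(\<V> n)"
    by (elim exE conjE)
  then have \<V>: "\<And>n. finite (\<V> n)" "\<And>n. \<V> n \<subseteq> range (\<lambda>k. W n k \<inter> S)"
    by simp_all
  have "\<exists>k. \<Union>(\<V> n) \<subseteq> W n k \<inter> S" for n
  proof -
    have "mono (\<lambda>k. W n k \<inter> S)"
      using mono[of n] by (auto simp: mono_def)
    then show ?thesis
      by (rule finite_subfamily_of_increasing[OF _ \<V>(1)[of n] \<V>(2)[of n]]) (rule exI)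
  qed
  then obtain f where f: "\<And>n. \<Union>(\<V> n) \<subseteq> W n (f n) \<inter> S"
    by metis
  have "\<exists>n. x \<in> W n (f n)" if "x \<in> S" for x
  proof -
    obtain n where "x \<in> \<Union>(\<V> n)"
      using bspec[OF x, of x] \<open>x \<in> S\<close> \<open>S \<subseteq> topspace X\<close> by auto
    then show ?thesis
      using f[of n] by blast
  qed
  then show ?thesis
    by blast
qed

text \<open>For every \<open>m\<close> the Menger property, applied to the covers from the \<open>m\<close>-th one on, gives a
  function \<open>h\<^sub>m\<close>, indexed from \<open>m\<close> on, that captures each point at some index \<open>\<ge> m\<close>. The pointwise
  maximum of the functions already started lies above every \<open>h\<^sub>m\<close> from \<open>m\<close> on, hence inherits these
  captures for all \<open>m\<close> at once.\<close>

lemma menger_increasing_covers_infinitely_often: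
  fixes W :: "nat \<Rightarrow> nat \<Rightarrow> 'a set"
  assumes "menger_space (subtopology X S)" "S \<subseteq> topspace X"
    and "\<And>n k. openin X (W n k)" and mono: "\<And>n. mono (W n)"
    and "\<And>n. S \<subseteq> (\<Union>k. W n k)"
  shows "\<exists>f. \<forall>x\<in>S. \<exists>\<^sub>\<infinity>n. x \<in> W n (f n)"
proof -
  have "\<exists>f. \<forall>x\<in>S. \<exists>n. x \<in> W (m + n) (f n)" for m
    using assms by (intro menger_increasing_covers[of X S "\<lambda>n. W (m + n)"])
  then obtain h where h: "\<And>m x. x \<in> S \<Longrightarrow> \<exists>n. x \<in> W (m + n) (h m n)"
    by metis
  \<comment> \<open>The shift \<open>n - m\<close> is there because \<open>h m\<close> numbers the covers starting from the \<open>m\<close>-th one.\<close>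
  define f where "f n = Max ((\<lambda>m. h m (n - m)) ` {..n})" for n
  have "\<exists>n\<ge>m. x \<in> W n (f n)" if "x \<in> S" for x m
  proof -
    obtain n where n: "x \<in> W (m + n) (h m n)"
      using h[OF \<open>x \<in> S\<close>] by blast
    have "h m n \<le> f (m + n)"
      unfolding f_def by (intro Max_ge image_eqI[where x = m]) auto
    then have "x \<in> W (m + n) (f (m + n))"
      using n mono[of "m + n"] by (meson monoD subsetD)
    then show ?thesis
      by (meson le_add1)
  qed
  then have "\<forall>x\<in>S. \<exists>\<^sub>\<infinity>n. x \<in> W n (f n)"
    by (simp add: INFM_nat_le)
  then show ?thesis
    by blast
qed

section \<open>Stars of finite sets\<close>

lemma countable_increasing_finite_exhaustion:
  assumes "countable C"
  obtains E :: "nat \<Rightarrow> 'a set" where "\<And>k. finite (E k)" "mono E" "(\<Union>k. E k) = C"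
proof -
  define E where "E k = {c \<in> C. to_nat_on C c \<le> k}" for k
  have "finite (E k)" for k
  proof (rule inj_on_finite)
    show "inj_on (to_nat_on C) (E k)"
      using inj_on_to_nat_on[OF assms] by (rule inj_on_subset) (auto simp: E_def)
    show "to_nat_on C ` E k \<subseteq> {..k}"
      by (auto simp: E_def)
  qed simp
  moreover have "mono E"
    by (auto simp: mono_def E_def)
  moreover have "(\<Union>k. E k) = C"
    by (auto simp: E_def)
  ultimately show ?thesis
    by (rule that)
qed

lemma star_mono:
  assumes "A \<subseteq> B"
  shows "star A \<U> \<subseteq> star B \<U>"
  using assms unfolding star_def by blast

lemma star_UN: "star (\<Union>i\<in>I. A i) \<U> = (\<Union>i\<in>I. star (A i) \<U>)"
  unfolding star_def by blast

lemma openin_star: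
  assumes "open_cover X \<U>"
  shows "openin X (star A \<U>)"
  using assms unfolding star_def open_cover_def by (intro openin_Union) auto

lemma abs_strongly_star_lindelof_finite_exhaustion:
  fixes \<U> :: "nat \<Rightarrow> 'a set set" and D :: "nat \<Rightarrow> 'a set"
  assumes "abs_strongly_star_lindelof X"
    and "\<And>n. open_cover X (\<U> n)" and "\<And>n. dense_subset X (D n)"
  obtains E :: "nat \<Rightarrow> nat \<Rightarrow> 'a set"
  where "\<And>n k. finite (E n k)" "\<And>n k. E n k \<subseteq> D n" "\<And>n. mono (E n)"
    "\<And>n. (\<Union>k. star (E n k) (\<U> n)) = topspace X"
proof -
  have "\<forall>n. \<exists>E::nat \<Rightarrow> 'a set. (\<forall>k. finite (E k)) \<and> (\<forall>k. E k \<subseteq> D n) \<and> mono E \<and>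
      (\<Union>k. star (E k) (\<U> n)) = topspace X"
  proof
    fix n
    obtain C where C: "countable C" "C \<subseteq> D n" "star C (\<U> n) = topspace X"
      using assms unfolding abs_strongly_star_lindelof_def by meson
    obtain E :: "nat \<Rightarrow> 'a set" where E: "\<And>k. finite (E k)" "mono E" "(\<Union>k. E k) = C"
      using countable_increasing_finite_exhaustion[OF C(1)] by blast
    have "(\<Union>k. star (E k) (\<U> n)) = topspace X"
      using C(3) unfolding star_UN[symmetric] E(3) .
    moreover have "\<forall>k. E k \<subseteq> D n"
      using E(3) C(2) by blast
    ultimately show "\<exists>E::nat \<Rightarrow> 'a set. (\<forall>k. finite (E k)) \<and> (\<forall>k. E k \<subseteq> D n) \<and> mono E \<and>
      (\<Union>k. star (E k) (\<U> n)) = topspace X"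
      using E(1,2) by (intro exI[of _ E]) simp
  qed
  from choice[OF this]
  obtain E :: "nat \<Rightarrow> nat \<Rightarrow> 'a set"
    where "\<forall>n. (\<forall>k. finite (E n k)) \<and> (\<forall>k. E n k \<subseteq> D n) \<and>
      mono (E n) \<and> (\<Union>k. star (E n k) (\<U> n)) = topspace X" ..
  then show ?thesis
    using that[of E] by simp
qed

text \<open>The choice of the finite sets is reduced to the choice of one function. Here \<open>Q\<close> says how often
  a piece is captured by its own function (almost always or infinitely often), \<open>R\<close> how often the
  points of \<open>X\<close> have to be captured, and \<open>P n k\<close> stands for capture of a point at the \<open>n\<close>-th cover
  with index \<open>k\<close>, which persists when \<open>k\<close> grows. Everything specific to \<open>\<bb>\<close> or \<open>\<dd>\<close> and to Hurewicz or
  Menger is thereby confined to \<open>combine\<close> and \<open>piece\<close>.\<close>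

lemma select_finite_sets:
  fixes \<U> :: "nat \<Rightarrow> 'a set set" and D :: "nat \<Rightarrow> 'a set"
    and Q R :: "(nat \<Rightarrow> bool) \<Rightarrow> bool"
  assumes aSSL: "abs_strongly_star_lindelof X"
    and cover: "\<And>n. open_cover X (\<U> n)" and dense: "\<And>n. dense_subset X (D n)"
    and un: "\<Union>\<S> = topspace X"
    and piece: "\<And>S W. S \<in> \<S> \<Longrightarrow> S \<subseteq> topspace X \<Longrightarrow> (\<And>n k. openin X (W n k)) \<Longrightarrow>
      (\<And>n. mono (W n)) \<Longrightarrow> (\<And>n. S \<subseteq> (\<Union>k::nat. W n k)) \<Longrightarrow>
      \<exists>f. \<forall>x\<in>S. Q (\<lambda>n. x \<in> W n (f n))"
    and combine: "\<And>f :: 'a set \<Rightarrow> nat \<Rightarrow> nat. \<exists>g. \<forall>S\<in>\<S>. \<forall>P.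
      Q (\<lambda>n. P n (f S n)) \<longrightarrow> (\<forall>n i j. i \<le> j \<longrightarrow> P n i \<longrightarrow> P n j) \<longrightarrow> R (\<lambda>n. P n (g n))"
  shows "\<exists>F. (\<forall>n. finite (F n) \<and> F n \<subseteq> D n) \<and>
    (\<forall>x\<in>topspace X. R (\<lambda>n. x \<in> star (F n) (\<U> n)))"
proof -
  obtain E :: "nat \<Rightarrow> nat \<Rightarrow> 'a set"
    where E: "\<And>n k. finite (E n k)" "\<And>n k. E n k \<subseteq> D n" "\<And>n. mono (E n)"
      "\<And>n. (\<Union>k. star (E n k) (\<U> n)) = topspace X"
    using abs_strongly_star_lindelof_finite_exhaustion[OF aSSL, of \<U> D] cover dense by blast
  have grow: "star (E n i) (\<U> n) \<subseteq> star (E n j) (\<U> n)" if "i \<le> j" for n i j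
    using that E(3) by (intro star_mono) (simp add: monoD)
  have "\<exists>f. \<forall>x\<in>S. Q (\<lambda>n. x \<in> star (E n (f n)) (\<U> n))" if "S \<in> \<S>" for S
  proof (rule piece[OF that])
    show "S \<subseteq> topspace X" "\<And>n. S \<subseteq> (\<Union>k. star (E n k) (\<U> n))"
      using that un E(4) by auto
    show "\<And>n k. openin X (star (E n k) (\<U> n))"
      using cover by (rule openin_star)
    show "\<And>n. mono (\<lambda>k. star (E n k) (\<U> n))"
      using grow by (auto simp: mono_def)
  qed
  then obtain f where f: "\<And>S x. S \<in> \<S> \<Longrightarrow> x \<in> S \<Longrightarrow> Q (\<lambda>n. x \<in> star (E n (f S n)) (\<U> n))"
    by metis
  from combine[of f] obtain g where g: "\<forall>S\<in>\<S>. \<forall>P. Q (\<lambda>n. P n (f S n)) \<longrightarrow>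
      (\<forall>n i j. i \<le> j \<longrightarrow> P n i \<longrightarrow> P n j) \<longrightarrow> R (\<lambda>n. P n (g n))" ..
  have "R (\<lambda>n. x \<in> star (E n (g n)) (\<U> n))" if "x \<in> topspace X" for x
  proof -
    obtain S where S: "S \<in> \<S>" "x \<in> S"
      using \<open>x \<in> topspace X\<close> un by blast
    show ?thesis
    proof (rule g[THEN bspec, THEN spec, THEN mp, THEN mp, of S "\<lambda>n k. x \<in> star (E n k) (\<U> n)"])
      show "Q (\<lambda>n. x \<in> star (E n (f S n)) (\<U> n))"
        using S by (rule f)
    qed (use S(1) grow in blast)+
  qed
  with E(1,2) show ?thesis
    by (intro exI[of _ "\<lambda>n. E n (g n)"]) simp
qed

section \<open>Unions of few Hurewicz or Menger pieces\<close>

lemma sel_strongly_star_menger_if_fewer_than_dominating_hurewicz: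
  assumes "aSSL_fewer dominating_number hurewicz_space X"
  shows "sel_strongly_star_menger X"
  unfolding sel_strongly_star_menger_def
proof (intro allI impI)
  fix \<U> :: "nat \<Rightarrow> 'a set set" and D :: "nat \<Rightarrow> 'a set"
  assume UD: "(\<forall>n. open_cover X (\<U> n)) \<and> (\<forall>n. dense_subset X (D n))"
  obtain \<S> where aSSL: "abs_strongly_star_lindelof X"
    and \<S>: "(card_of \<S>, dominating_number) \<in> ordLess" "\<Union>\<S> = topspace X"
    and H: "\<And>S. S \<in> \<S> \<Longrightarrow> hurewicz_space (subtopology X S)"
    using assms unfolding aSSL_fewer_def union_of_fewer_def by blast
  show "\<exists>F. (\<forall>n. finite (F n) \<and> F n \<subseteq> D n) \<and>
      (\<forall>x\<in>topspace X. \<exists>n. x \<in> star (F n) (\<U> n))"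
  proof (rule select_finite_sets[where Q = "\<lambda>P. \<forall>\<^sub>\<infinity>n. P n" and \<S> = \<S>, OF aSSL])
    fix f :: "'a set \<Rightarrow> nat \<Rightarrow> nat"
    obtain g where g: "\<And>S. S \<in> \<S> \<Longrightarrow> \<exists>\<^sub>\<infinity>n. f S n < g n"
      using not_dominated_if_fewer_than_dominating_number[OF \<S>(1)] by blast
    have "\<exists>n. P n (g n)"
      if "S \<in> \<S>" "\<forall>\<^sub>\<infinity>n. P n (f S n)" "\<forall>n i j. i \<le> j \<longrightarrow> P n i \<longrightarrow> P n j" for S P
    proof -
      have "\<exists>\<^sub>\<infinity>n. P n (f S n) \<and> f S n < g n"
        using INFM_conjI[OF g[OF that(1)] that(2)] by (simp add: conj_commute)
      then obtain n where "P n (f S n)" "f S n < g n"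
        using INFM_EX by blast
      then show ?thesis
        using that(3) less_imp_le by blast
    qed
    then show "\<exists>g. \<forall>S\<in>\<S>. \<forall>P. (\<forall>\<^sub>\<infinity>n. P n (f S n)) \<longrightarrow>
        (\<forall>n i j. i \<le> j \<longrightarrow> P n i \<longrightarrow> P n j) \<longrightarrow> (\<exists>n. P n (g n))"
      by blast
  qed (simp_all add: UD \<S>(2) hurewicz_increasing_covers[OF H])
qed

lemma sel_strongly_star_hurewicz_if_fewer_than_bounding_hurewicz:
  assumes "aSSL_fewer bounding_number hurewicz_space X"
  shows "sel_strongly_star_hurewicz X"
  unfolding sel_strongly_star_hurewicz_def
proof (intro allI impI)
  fix \<U> :: "nat \<Rightarrow> 'a set set" and D :: "nat \<Rightarrow> 'a set"
  assume UD: "(\<forall>n. open_cover X (\<U> n)) \<and> (\<forall>n. dense_subset X (D n))"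
  obtain \<S> where aSSL: "abs_strongly_star_lindelof X"
    and \<S>: "(card_of \<S>, bounding_number) \<in> ordLess" "\<Union>\<S> = topspace X"
    and H: "\<And>S. S \<in> \<S> \<Longrightarrow> hurewicz_space (subtopology X S)"
    using assms unfolding aSSL_fewer_def union_of_fewer_def by blast
  show "\<exists>F. (\<forall>n. finite (F n) \<and> F n \<subseteq> D n) \<and>
      (\<forall>x\<in>topspace X. \<forall>\<^sub>\<infinity>n. x \<in> star (F n) (\<U> n))"
  proof (rule select_finite_sets[where Q = "\<lambda>P. \<forall>\<^sub>\<infinity>n. P n" and \<S> = \<S>, OF aSSL])
    fix f :: "'a set \<Rightarrow> nat \<Rightarrow> nat"
    obtain g where g: "\<And>S. S \<in> \<S> \<Longrightarrow> le_star (f S) g"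
      using bounded_if_fewer_than_bounding_number[OF \<S>(1)] by blast
    have "\<forall>\<^sub>\<infinity>n. P n (g n)"
      if "S \<in> \<S>" "\<forall>\<^sub>\<infinity>n. P n (f S n)" "\<forall>n i j. i \<le> j \<longrightarrow> P n i \<longrightarrow> P n j" for S P
      using that(2) g[OF that(1), unfolded le_star_def]
      by (rule MOST_rev_mp[OF MOST_conjI]) (use that(3) in \<open>auto intro: MOST_I\<close>)
    then show "\<exists>g. \<forall>S\<in>\<S>. \<forall>P. (\<forall>\<^sub>\<infinity>n. P n (f S n)) \<longrightarrow>
        (\<forall>n i j. i \<le> j \<longrightarrow> P n i \<longrightarrow> P n j) \<longrightarrow> (\<forall>\<^sub>\<infinity>n. P n (g n))"
      by blast
  qed (simp_all add: UD \<S>(2) hurewicz_increasing_covers[OF H])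
qed

lemma sel_strongly_star_menger_if_fewer_than_bounding_menger:
  assumes "aSSL_fewer bounding_number menger_space X"
  shows "sel_strongly_star_menger X"
  unfolding sel_strongly_star_menger_def
proof (intro allI impI)
  fix \<U> :: "nat \<Rightarrow> 'a set set" and D :: "nat \<Rightarrow> 'a set"
  assume UD: "(\<forall>n. open_cover X (\<U> n)) \<and> (\<forall>n. dense_subset X (D n))"
  obtain \<S> where aSSL: "abs_strongly_star_lindelof X"
    and \<S>: "(card_of \<S>, bounding_number) \<in> ordLess" "\<Union>\<S> = topspace X"
    and M: "\<And>S. S \<in> \<S> \<Longrightarrow> menger_space (subtopology X S)"
    using assms unfolding aSSL_fewer_def union_of_fewer_def by blast
  show "\<exists>F. (\<forall>n. finite (F n) \<and> F n \<subseteq> D n) \<and>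
      (\<forall>x\<in>topspace X. \<exists>n. x \<in> star (F n) (\<U> n))"
  proof (rule select_finite_sets[where Q = "\<lambda>P. \<exists>\<^sub>\<infinity>n. P n" and \<S> = \<S>, OF aSSL])
    fix f :: "'a set \<Rightarrow> nat \<Rightarrow> nat"
    obtain g where g: "\<And>S. S \<in> \<S> \<Longrightarrow> le_star (f S) g"
      using bounded_if_fewer_than_bounding_number[OF \<S>(1)] by blast
    have "\<exists>n. P n (g n)"
      if "S \<in> \<S>" "\<exists>\<^sub>\<infinity>n. P n (f S n)" "\<forall>n i j. i \<le> j \<longrightarrow> P n i \<longrightarrow> P n j" for S P
    proof -
      have "\<exists>\<^sub>\<infinity>n. P n (f S n) \<and> f S n \<le> g n"
        using INFM_conjI[OF that(2) g[OF that(1), unfolded le_star_def]] .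
      then obtain n where "P n (f S n)" "f S n \<le> g n"
        using INFM_EX by blast
      then show ?thesis
        using that(3) by blast
    qed
    then show "\<exists>g. \<forall>S\<in>\<S>. \<forall>P. (\<exists>\<^sub>\<infinity>n. P n (f S n)) \<longrightarrow>
        (\<forall>n i j. i \<le> j \<longrightarrow> P n i \<longrightarrow> P n j) \<longrightarrow> (\<exists>n. P n (g n))"
      by blast
  qed (simp_all add: UD \<S>(2) menger_increasing_covers_infinitely_often[OF M])
qed

theorem theorem2p19:
  fixes X :: "'a topology"
  assumes "regular_space X" and "t1_space X"
  shows "(aSSL_fewer dominating_number hurewicz_space X \<longrightarrow> sel_strongly_star_menger X)
    \<and> (aSSL_fewer bounding_number hurewicz_space X \<longrightarrow> sel_strongly_star_hurewicz X)
    \<and> (aSSL_fewer bounding_number menger_space X \<longrightarrow> sel_strongly_star_menger X)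
    \<and> (aSSL_fewer bounding_number hurewicz_space X \<longrightarrow>
         aSSL_fewer dominating_number hurewicz_space X)
    \<and> (aSSL_fewer bounding_number hurewicz_space X \<longrightarrow>
         aSSL_fewer bounding_number menger_space X)
    \<and> (sel_strongly_star_hurewicz X \<longrightarrow> sel_strongly_star_menger X)"
proof (intro conjI impI)
  show "sel_strongly_star_menger X" if "aSSL_fewer dominating_number hurewicz_space X"
    using that by (rule sel_strongly_star_menger_if_fewer_than_dominating_hurewicz)
  show "sel_strongly_star_hurewicz X" if "aSSL_fewer bounding_number hurewicz_space X"
    using that by (rule sel_strongly_star_hurewicz_if_fewer_than_bounding_hurewicz)
  show "sel_strongly_star_menger X" if "aSSL_fewer bounding_number menger_space X"
    using that by (rule sel_strongly_star_menger_if_fewer_than_bounding_menger)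
  show "aSSL_fewer dominating_number hurewicz_space X"
    if "aSSL_fewer bounding_number hurewicz_space X"
    using that union_of_fewer_mono[OF _ bounding_number_le_dominating_number,
        of hurewicz_space X hurewicz_space]
    unfolding aSSL_fewer_def by simp
  show "aSSL_fewer bounding_number menger_space X"
    if "aSSL_fewer bounding_number hurewicz_space X"
    using that menger_space_if_hurewicz_space
    unfolding aSSL_fewer_def union_of_fewer_def by fast
  show "sel_strongly_star_menger X" if "sel_strongly_star_hurewicz X"
    using that by (rule sel_strongly_star_menger_if_hurewicz)
qed

end
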